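(* Let $K\ge 2$, $Y=(Y_1,\dots,Y_K)'\in\mathbb{R}^K$, $\sigma_1,\dots,\sigma_K>0$, and let $\Lambda\subseteq\Delta(\mathcal{V})$ be nonempty, compact, and convex. The optimal headline $\hat\theta_\Lambda^*(Y)=\arg\min_{a\in\mathbb{R}}R_\Lambda(a|Y)$ exists uniquely. Moreover, there exists $\lambda^*\in\Lambda$ such that $$\lambda^*\in\arg\max_{\lambda\in\Lambda}\rho(\lambda|Y),\qquad \hat\theta_\Lambda^*(Y)=a(\lambda^*|Y),\qquad R_\Lambda^*(Y)=\rho(\lambda^*|Y)+1,$$ and $\lambda^*$ is a worst-case design prior at $a=\hat\theta_\Lambda^*(Y)$: $$R_\Lambda(\hat\theta_\Lambda^*(Y)|Y)=R_{\lambda^*}(\hat\theta_\Lambda^*(Y)|Y).$$ For $K=2$, write $\lambda(p)=(p,1-p)'$ and define $p_\Delta=\sigma_1/(\sigma_1+\sigma_2)$, which satisfies (uniquely when $Y_1\ne Y_2$) $$p_\Delta\in\arg\max_{p\in[0,1]}\rho(\lambda(p)|Y),\qquad \rho(\lambda(p)|Y)=\frac{p(1-p)(Y_1-Y_2)^2}{p\sigma_2^2+(1-p)\sigma_1^2}.$$ Define $\mathcal{I}_\Lambda=\{p\in[0,1]:\lambda(p)\in\Lambda\}=[\underline{p}_\Lambda,\overline{p}_\Lambda]$ and $$p_\Lambda^*=\arg\min_{p\in\mathcal{I}_\Lambda}|p-p_\Delta|=\min\{\max\{p_\Delta,\underline{p}_\Lambda\},\overline{p}_\Lambda\}.$$ In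 this case, $$\hat\theta_\Lambda^*(Y)=\frac{p_\Lambda^*Y_1/\sigma_1^2+(1-p_\Lambda^* )Y_2/\sigma_2^2}{p_\Lambda^*/\sigma_1^2+(1-p_\Lambda^* )/\sigma_2^2},\qquad R_\Lambda^*(Y)=\frac{p_\Lambda^*(1-p_\Lambda^* )(Y_1-Y_2)^2}{p_\Lambda^*\sigma_2^2+(1-p_\Lambda^* )\sigma_1^2}+1.$$ If $Y_1\ne Y_2$, then $\lambda(p_\Lambda^* )$ is the unique least favorable design prior. If $Y_1=Y_2$, then every $\lambda\in\Lambda$ is least favorable and $\hat\theta_\Lambda^*(Y)=Y_1=Y_2$ with $R_\Lambda^*(Y)=1$.
   Context: $\Delta(\mathcal{V})=\{\lambda\in\mathbb{R}^K:\lambda\ge 0,\ \sum_{k=1}^K\lambda_k=1\}$ is the standard simplex (the set of design priors). For $a\in\mathbb{R}$ let $D_k(a|Y)=|Y_k-a|/\sigma_k$, $$R_\lambda(a|Y)=\sum_{k=1}^K\lambda_kD_k(a|Y)^2+1,\qquad R_\Lambda(a|Y)=\max_{\lambda\in\Lambda}R_\lambda(a|Y),\qquad R_\Lambda^*(Y)=\min_{a\in\mathbb{R}}R_\Lambda(a|Y).$$ For $\lambda\in\Delta(\mathcal{V})$ define $$a(\lambda|Y)=\frac{\sum_{k}\lambda_kY_k/\sigma_k^2}{\sum_{k}\lambda_k/\sigma_k^2},\qquad \rho(\lambda|Y)=\sum_{k}\lambda_kD_k(a(\lambda|Y)|Y)^2=\frac{\sum_{j<k}(Y_j-Y_k)^2(\lambda_j/\sigma_j^2)(\lambda_k/\sigma_k^2)}{\sum_{\ell}\lambda_\ell/\sigma_\ell^2}.$$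 A design prior $\lambda\in\Lambda$ is called least favorable if it maximizes $\rho(\cdot|Y)$ over $\Lambda$. *)

theory Defs
  imports "HOL-Analysis.Analysis"
begin

text \<open>
  Vectors in \<open>\<real>\<^sup>K\<close> are rendered as \<open>real^'k\<close>, with \<open>K = CARD('k)\<close>. The standard errors
  \<open>\<sigma>\<close> and the estimates \<open>Y\<close> are explicit arguments.
\<close>

definition design_priors :: "(real^'k) set" where
  "design_priors = {l. (\<forall>k. 0 \<le> l $ k) \<and> (\<Sum>k\<in>UNIV. l $ k) = 1}"

definition D :: "real^'k \<Rightarrow> real^'k \<Rightarrow> 'k \<Rightarrow> real \<Rightarrow> real" where
  "D \<sigma> Y k a = \<bar>Y $ k - a\<bar> / \<sigma> $ k"

definition risk :: "real^'k \<Rightarrow> real^'k \<Rightarrow> real^'k \<Rightarrow> real \<Rightarrow> real" where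
  "risk \<sigma> Y l a = (\<Sum>k\<in>UNIV. l $ k * (D \<sigma> Y k a)\<^sup>2) + 1"

text \<open>
  The maximum over \<open>\<Lambda>\<close> is written as a supremum; it is attained for nonempty compact \<open>\<Lambda>\<close>,
  see \<open>worst_case_risk_is_max\<close> below. Likewise the minimum in \<open>minimax_risk\<close> is an infimum,
  which is a minimum as soon as a minimiser exists.
\<close>

definition worst_case_risk :: "real^'k \<Rightarrow> real^'k \<Rightarrow> (real^'k) set \<Rightarrow> real \<Rightarrow> real" where
  "worst_case_risk \<sigma> Y \<Lambda> a = (SUP l\<in>\<Lambda>. risk \<sigma> Y l a)"

definition minimax_risk :: "real^'k \<Rightarrow> real^'k \<Rightarrow> (real^'k) set \<Rightarrow> real" where
  "minimax_risk \<sigma> Y \<Lambda> = (INF a. worst_case_risk \<sigma> Y \<Lambda> a)"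

definition is_optimal_headline :: "real^'k \<Rightarrow> real^'k \<Rightarrow> (real^'k) set \<Rightarrow> real \<Rightarrow> bool" where
  "is_optimal_headline \<sigma> Y \<Lambda> a \<longleftrightarrow> is_arg_min (worst_case_risk \<sigma> Y \<Lambda>) (\<lambda>_. True) a"

definition optimal_headline :: "real^'k \<Rightarrow> real^'k \<Rightarrow> (real^'k) set \<Rightarrow> real" where
  "optimal_headline \<sigma> Y \<Lambda> = arg_min (worst_case_risk \<sigma> Y \<Lambda>) (\<lambda>_. True)"

definition prior_headline :: "real^'k \<Rightarrow> real^'k \<Rightarrow> real^'k \<Rightarrow> real" where
  "prior_headline \<sigma> Y l =
     (\<Sum>k\<in>UNIV. l $ k * Y $ k / (\<sigma> $ k)\<^sup>2) / (\<Sum>k\<in>UNIV. l $ k / (\<sigma> $ k)\<^sup>2)"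

definition rho :: "real^'k \<Rightarrow> real^'k \<Rightarrow> real^'k \<Rightarrow> real" where
  "rho \<sigma> Y l = (\<Sum>k\<in>UNIV. l $ k * (D \<sigma> Y k (prior_headline \<sigma> Y l))\<^sup>2)"

definition least_favorable :: "real^'k \<Rightarrow> real^'k \<Rightarrow> (real^'k) set \<Rightarrow> real^'k \<Rightarrow> bool" where
  "least_favorable \<sigma> Y \<Lambda> l \<longleftrightarrow> is_arg_max (rho \<sigma> Y) (\<lambda>m. m \<in> \<Lambda>) l"

text \<open>
  The case \<open>K = 2\<close>. The index type is then \<open>{k1, k2}\<close> with \<open>k1 \<noteq> k2\<close>; the first coordinate is
  the one at \<open>k1\<close>, the second the one at \<open>k2\<close>.
\<close>

definition two_prior :: "'k \<Rightarrow> real \<Rightarrow> real^'k" where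
  "two_prior k1 p = (\<chi> k. if k = k1 then p else 1 - p)"

definition p_Delta :: "real^'k \<Rightarrow> 'k \<Rightarrow> 'k \<Rightarrow> real" where
  "p_Delta \<sigma> k1 k2 = \<sigma> $ k1 / (\<sigma> $ k1 + \<sigma> $ k2)"

definition I_set :: "(real^'k) set \<Rightarrow> 'k \<Rightarrow> real set" where
  "I_set \<Lambda> k1 = {p \<in> {0..1}. two_prior k1 p \<in> \<Lambda>}"

definition p_lower :: "(real^'k) set \<Rightarrow> 'k \<Rightarrow> real" where
  "p_lower \<Lambda> k1 = Inf (I_set \<Lambda> k1)"

definition p_upper :: "(real^'k) set \<Rightarrow> 'k \<Rightarrow> real" where
  "p_upper \<Lambda> k1 = Sup (I_set \<Lambda> k1)"

definition p_star :: "real^'k \<Rightarrow> (real^'k) set \<Rightarrow> 'k \<Rightarrow> 'k \<Rightarrow> real" where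
  "p_star \<sigma> \<Lambda> k1 k2 = arg_min (\<lambda>p. \<bar>p - p_Delta \<sigma> k1 k2\<bar>) (\<lambda>p. p \<in> I_set \<Lambda> k1)"


lemma worst_case_risk_is_max:
  assumes "compact \<Lambda>" and "\<Lambda> \<noteq> {}"
  shows "\<exists>l\<in>\<Lambda>. worst_case_risk \<sigma> Y \<Lambda> a = risk \<sigma> Y l a \<and> (\<forall>m\<in>\<Lambda>. risk \<sigma> Y m a \<le> risk \<sigma> Y l a)"
proof -
  have "continuous_on \<Lambda> (\<lambda>l. risk \<sigma> Y l a)"
    unfolding risk_def by (intro continuous_intros)
  then obtain l where l: "l \<in> \<Lambda>" "\<forall>m\<in>\<Lambda>. risk \<sigma> Y m a \<le> risk \<sigma> Y l a"
    using continuous_attains_sup[OF assms] by blast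
  then have "worst_case_risk \<sigma> Y \<Lambda> a = risk \<sigma> Y l a"
    unfolding worst_case_risk_def by (intro cSup_eq_maximum) auto
  with l show ?thesis by blast
qed

lemma rho_pairwise:
  fixes \<sigma> Y l :: "real^'k::{finite,linorder}"
  assumes \<sigma>: "\<forall>k. 0 < \<sigma> $ k" and l: "l \<in> design_priors"
  shows "rho \<sigma> Y l =
    (\<Sum>(j,k)\<in>{(j,k). j < k}. (Y $ j - Y $ k)\<^sup>2 * (l $ j / (\<sigma> $ j)\<^sup>2) * (l $ k / (\<sigma> $ k)\<^sup>2))
      / (\<Sum>k\<in>UNIV. l $ k / (\<sigma> $ k)\<^sup>2)"
proof -
  define w where "w k = l $ k / (\<sigma> $ k)\<^sup>2" for k
  define y where "y k = Y $ k" for k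
  define W where "W = sum w UNIV"
  define S where "S = (\<Sum>k\<in>UNIV. w k * y k)"
  define Q where "Q = (\<Sum>k\<in>UNIV. w k * (y k)\<^sup>2)"
  define f where "f = (\<lambda>(j,k). (y j - y k)\<^sup>2 * w j * w k)"
  have w0: "w k \<ge> 0" for k
    using l by (simp add: w_def design_priors_def)
  have "\<exists>k. l $ k \<noteq> 0"
  proof (rule ccontr)
    assume "\<nexists>k. l $ k \<noteq> 0"
    then show False
      using l by (simp add: design_priors_def)
  qed
  then obtain k0 where "l $ k0 \<noteq> 0" by blast
  then have "w k0 > 0"
    using w0[of k0] \<sigma> by (simp add: w_def less_le)
  then have W: "W > 0"
    unfolding W_def using w0 by (intro sum_pos2[of _ k0]) auto
  have a: "prior_headline \<sigma> Y l = S / W"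
    by (simp add: prior_headline_def S_def W_def w_def y_def)
  have "rho \<sigma> Y l = (\<Sum>k\<in>UNIV. w k * (y k - S / W)\<^sup>2)"
    by (simp add: rho_def D_def a w_def y_def power_divide)
  also have "\<dots> = (\<Sum>k\<in>UNIV. w k * (y k)\<^sup>2 - 2 * (S / W) * (w k * y k) + (S / W)\<^sup>2 * w k)"
    by (intro sum.cong) (auto simp: power2_eq_square algebra_simps)
  also have "\<dots> = Q - 2 * (S / W) * S + (S / W)\<^sup>2 * W"
    by (simp add: sum.distrib sum_subtractf sum_distrib_left Q_def S_def W_def)
  also have "\<dots> = (Q * W - S\<^sup>2) / W"
    using W by (simp add: field_simps power2_eq_square)
  finally have rho: "rho \<sigma> Y l = (Q * W - S\<^sup>2) / W" .
  have "sum f UNIV = (\<Sum>j\<in>UNIV. \<Sum>k\<in>UNIV. (y j - y k)\<^sup>2 * w j * w k)"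
    by (simp add: f_def sum.cartesian_product)
  also have "\<dots> = (\<Sum>j\<in>UNIV. \<Sum>k\<in>UNIV. (w j * (y j)\<^sup>2) * w k + w j * (w k * (y k)\<^sup>2)
      - 2 * ((w j * y j) * (w k * y k)))"
    by (intro sum.cong) (auto simp: power2_eq_square algebra_simps)
  also have "\<dots> = Q * W + W * Q - 2 * (S * S)"
    by (simp add: sum.distrib sum_subtractf Q_def W_def S_def sum_product
        flip: sum_distrib_left)
  finally have full: "sum f UNIV = 2 * (Q * W - S\<^sup>2)"
    by (simp add: power2_eq_square)
  let ?L = "{(j::'k,k). j < k}" and ?G = "{(j::'k,k). k < j}" and ?E = "{(j::'k,k). j = k}"
  have U: "UNIV = ?L \<union> ?G \<union> ?E" by auto
  have "sum f UNIV = sum f ?L + sum f ?G + sum f ?E"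
    by (subst U, subst sum.union_disjoint, (auto)[3], subst sum.union_disjoint) auto
  also have "sum f ?E = 0"
    by (intro sum.neutral) (auto simp: f_def)
  also have "sum f ?G = sum f ?L"
    by (rule sum.reindex_bij_witness[of _ prod.swap prod.swap])
      (auto simp: f_def power2_commute mult_ac)
  finally have "sum f ?L = Q * W - S\<^sup>2"
    using full by simp
  then show ?thesis
    using rho by (simp add: f_def w_def y_def W_def)
qed

end

theory Submission
  imports Defs
begin

text \<open>
  For a fixed action the risk is affine in the prior; for a fixed prior it is a parabola in the
  action with vertex at \<open>prior_headline\<close> and minimum \<open>rho + 1\<close>. Let \<open>l\<close> maximise \<open>rho\<close> over \<open>\<Lambda>\<close>, let
  \<open>m \<in> \<Lambda>\<close> and let \<open>a\<^sub>t\<close> be the headline of \<open>(1 - t) l + t m\<close>. Splitting the risk of the mixture at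
  \<open>a\<^sub>t\<close> and using maximality of \<open>l\<close> gives \<open>risk m a\<^sub>t \<le> rho l + 1\<close> for \<open>t > 0\<close>; letting \<open>t \<rightarrow> 0\<close> shows
  that \<open>l\<close> and its headline form a saddle point. For two sources, \<open>rho\<close> is concave along the segment of
  priors with a strict maximum at \<open>p_Delta\<close>, so over a subinterval it is maximised exactly at the
  point closest to \<open>p_Delta\<close>.
\<close>

section \<open>Risk as a function of the prior and of the action\<close>

lemma convex_design_priors: "convex (design_priors :: (real^'k) set)"
proof (rule convexI)
  fix l m :: "real^'k" and u v :: real
  assume "l \<in> design_priors" "m \<in> design_priors" "0 \<le> u" "0 \<le> v" "u + v = 1"
  then show "u *\<^sub>R l + v *\<^sub>R m \<in> design_priors"
    by (simp add: design_priors_def sum.distrib flip: sum_distrib_left)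
qed

text \<open>Nonnegative weights with sum one cannot all vanish. This makes
  \<open>prior_headline\<close> a genuine quotient and the risk parabola strictly convex in the
  action.\<close>

lemma design_prior_precision_pos:
  fixes \<sigma> l :: "real^'k"
  assumes \<sigma>: "\<forall>k. 0 < \<sigma> $ k" and l: "l \<in> design_priors"
  shows "0 < (\<Sum>k\<in>UNIV. l $ k / (\<sigma> $ k)\<^sup>2)"
proof -
  have "\<exists>k. l $ k \<noteq> 0"
  proof (rule ccontr)
    assume "\<nexists>k. l $ k \<noteq> 0"
    then show False using l by (simp add: design_priors_def)
  qed
  then obtain k where "l $ k \<noteq> 0" by blast
  then have "0 < l $ k / (\<sigma> $ k)\<^sup>2"
    using \<sigma> l by (auto simp: design_priors_def less_le)
  then show ?thesis
    using l by (intro sum_pos2[of _ k]) (auto simp: design_priors_def)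
qed

lemma risk_prior_headline: "risk \<sigma> Y l (prior_headline \<sigma> Y l) = rho \<sigma> Y l + 1"
  by (simp add: risk_def rho_def)

text \<open>The weighted sum is linear in the prior; \<open>u + v = 1\<close> lets the additive
  constant \<open>1\<close> be split in the same proportions.\<close>

lemma risk_affine_prior:
  assumes "u + v = 1"
  shows "risk \<sigma> Y (u *\<^sub>R l + v *\<^sub>R m) a = u * risk \<sigma> Y l a + v * risk \<sigma> Y m a"
proof -
  have "risk \<sigma> Y (u *\<^sub>R l + v *\<^sub>R m) a =
      u * (risk \<sigma> Y l a - 1) + v * (risk \<sigma> Y m a - 1) + (u + v)"
    using assms by (simp add: risk_def distrib_right sum.distrib sum_distrib_left mult.assoc)
  then show ?thesis by (simp add: algebra_simps)
qed

text \<open>Completing the square in the action: the linear term vanishes at \<open>S / W\<close>.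
  The positive leading coefficient later gives uniqueness of the optimal headline.\<close>

lemma risk_vertex_form:
  assumes \<sigma>: "\<forall>k. 0 < \<sigma> $ k" and l: "l \<in> design_priors"
  shows "risk \<sigma> Y l a =
    rho \<sigma> Y l + 1 + (\<Sum>k\<in>UNIV. l $ k / (\<sigma> $ k)\<^sup>2) * (a - prior_headline \<sigma> Y l)\<^sup>2"
proof -
  define w where "w k = l $ k / (\<sigma> $ k)\<^sup>2" for k
  define W where "W = sum w UNIV"
  define S where "S = (\<Sum>k\<in>UNIV. w k * Y $ k)"
  define Q where "Q = (\<Sum>k\<in>UNIV. w k * (Y $ k)\<^sup>2)"
  have W: "W > 0"
    using design_prior_precision_pos[OF assms] by (simp add: W_def w_def)
  have expand: "risk \<sigma> Y l b = Q - 2 * b * S + b\<^sup>2 * W + 1" for b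
  proof -
    have "risk \<sigma> Y l b = (\<Sum>k\<in>UNIV. w k * (Y $ k)\<^sup>2 - 2 * b * (w k * Y $ k) + b\<^sup>2 * w k) + 1"
      unfolding risk_def D_def w_def
      by (intro arg_cong2[where f = "(+)"] sum.cong)
         (auto simp: power_divide power2_diff add_divide_distrib diff_divide_distrib algebra_simps)
    then show ?thesis
      by (simp add: sum.distrib sum_subtractf sum_distrib_left Q_def S_def W_def)
  qed
  have a: "prior_headline \<sigma> Y l = S / W"
    by (simp add: prior_headline_def S_def W_def w_def)
  have "risk \<sigma> Y l a = risk \<sigma> Y l (S / W) + W * (a - S / W)\<^sup>2"
    unfolding expand using W by (simp add: field_simps power2_eq_square)
  then show ?thesis
    using risk_prior_headline[of \<sigma> Y l] by (simp add: a W_def w_def)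
qed

lemma rho_le_risk:
  assumes "\<forall>k. 0 < \<sigma> $ k" and "l \<in> design_priors"
  shows "rho \<sigma> Y l + 1 \<le> risk \<sigma> Y l a"
  using risk_vertex_form[OF assms] design_prior_precision_pos[OF assms] by simp

section \<open>Concavity and continuity of \<open>rho\<close>\<close>

text \<open>As a function of the prior, \<open>rho + 1\<close> is the minimum over actions of affine
  functions, hence concave. Concretely, both endpoint risks are evaluated at the headline of the
  mixture.\<close>

lemma concave_on_rho:
  fixes \<sigma> Y :: "real^'k"
  assumes \<sigma>: "\<forall>k. 0 < \<sigma> $ k"
  shows "concave_on design_priors (rho \<sigma> Y)"
  unfolding concave_on_iff
proof (intro conjI ballI allI impI convex_design_priors)
  fix l m :: "real^'k" and u v :: real
  assume lm: "l \<in> design_priors" "m \<in> design_priors" and uv: "u \<ge> 0" "v \<ge> 0" "u + v = 1"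
  let ?n = "u *\<^sub>R l + v *\<^sub>R m"
  let ?a = "prior_headline \<sigma> Y ?n"
  have "u * (rho \<sigma> Y l + 1) + v * (rho \<sigma> Y m + 1) \<le> u * risk \<sigma> Y l ?a + v * risk \<sigma> Y m ?a"
    using uv lm \<sigma> by (intro add_mono mult_left_mono rho_le_risk) auto
  also have "\<dots> = rho \<sigma> Y ?n + 1"
    by (simp add: risk_affine_prior[OF uv(3), symmetric] risk_prior_headline)
  finally show "u * rho \<sigma> Y l + v * rho \<sigma> Y m \<le> rho \<sigma> Y ?n"
    using uv(3) by (simp add: algebra_simps)
qed

lemma continuous_on_prior_headline:
  assumes \<sigma>: "\<forall>k. 0 < \<sigma> $ k"
  shows "continuous_on design_priors (prior_headline \<sigma> Y)"
proof -
  have "\<forall>l\<in>design_priors. (\<Sum>k\<in>UNIV. l $ k / (\<sigma> $ k)\<^sup>2) \<noteq> 0"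
    using design_prior_precision_pos[OF \<sigma>] by fastforce
  moreover have "\<sigma> $ k \<noteq> 0" for k
    using \<sigma> by (metis less_irrefl)
  ultimately show ?thesis
    unfolding prior_headline_def by (intro continuous_intros) auto
qed

lemma continuous_on_rho:
  assumes \<sigma>: "\<forall>k. 0 < \<sigma> $ k"
  shows "continuous_on design_priors (rho \<sigma> Y)"
proof -
  have "\<sigma> $ k \<noteq> 0" for k
    using \<sigma> by (metis less_irrefl)
  then show ?thesis
    unfolding rho_def D_def
    by (intro continuous_intros continuous_on_prior_headline[OF \<sigma>]) auto
qed

section \<open>Least favorable priors as saddle points\<close>

lemma least_favorable_iff:
  "least_favorable \<sigma> Y \<Lambda> l \<longleftrightarrow> l \<in> \<Lambda> \<and> (\<forall>m\<in>\<Lambda>. rho \<sigma> Y m \<le> rho \<sigma> Y l)"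
  by (auto simp: least_favorable_def is_arg_max_linorder)

lemma least_favorable_exists:
  assumes "\<forall>k. 0 < \<sigma> $ k" "\<Lambda> \<subseteq> design_priors" "\<Lambda> \<noteq> {}" "compact \<Lambda>"
  shows "\<exists>l. least_favorable \<sigma> Y \<Lambda> l"
  using continuous_attains_sup[OF assms(4,3)
      continuous_on_subset[OF continuous_on_rho[OF assms(1)] assms(2)]]
  unfolding least_favorable_iff by blast

text \<open>The half of the saddle inequality that varies the prior; \<open>rho_le_risk\<close> is
  the half that varies the action. A perturbation along the segment from \<open>l\<close> to
  \<open>m\<close> takes the place of a minimax theorem.\<close>

lemma least_favorable_saddle:
  fixes \<sigma> Y :: "real^'k"
  assumes \<sigma>: "\<forall>k. 0 < \<sigma> $ k" and \<Lambda>: "\<Lambda> \<subseteq> design_priors" "convex \<Lambda>"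
    and l: "least_favorable \<sigma> Y \<Lambda> l" and m: "m \<in> \<Lambda>"
  shows "risk \<sigma> Y m (prior_headline \<sigma> Y l) \<le> rho \<sigma> Y l + 1"
proof -
  define mix where "mix t = (1 - t) *\<^sub>R l + t *\<^sub>R m" for t :: real
  define h where "h t = risk \<sigma> Y m (prior_headline \<sigma> Y (mix t))" for t
  have lm: "l \<in> \<Lambda>" "m \<in> \<Lambda>" and max: "\<And>n. n \<in> \<Lambda> \<Longrightarrow> rho \<sigma> Y n \<le> rho \<sigma> Y l"
    using l m by (auto simp: least_favorable_iff)
  have mix: "mix t \<in> \<Lambda>" if "t \<in> {0..1}" for t
    using that lm \<Lambda>(2) by (auto simp: mix_def convex_def)
  have "\<sigma> $ k \<noteq> 0" for k
    using \<sigma> by (metis less_irrefl)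
  moreover have "continuous_on {0..1} (\<lambda>t. prior_headline \<sigma> Y (mix t))"
  proof (rule continuous_on_compose2[OF continuous_on_prior_headline[OF \<sigma>]])
    show "continuous_on {0..1} mix"
      unfolding mix_def by (intro continuous_intros)
  qed (use mix \<Lambda>(1) in auto)
  ultimately have cont: "continuous_on {0..1} h"
    unfolding h_def risk_def D_def by (intro continuous_intros) auto
  have "h t \<le> rho \<sigma> Y l + 1" if t: "t \<in> {0<..<1}" for t
  proof -
    let ?a = "prior_headline \<sigma> Y (mix t)"
    have "(1 - t) * (rho \<sigma> Y l + 1) + t * h t \<le> (1 - t) * risk \<sigma> Y l ?a + t * h t"
      using t lm \<Lambda>(1) \<sigma> by (intro add_mono mult_left_mono rho_le_risk) auto
    also have "\<dots> = rho \<sigma> Y (mix t) + 1"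
      unfolding h_def using risk_affine_prior[of "1 - t" t \<sigma> Y l m ?a]
      by (simp add: risk_prior_headline flip: mix_def)
    also have "\<dots> \<le> rho \<sigma> Y l + 1"
      using t by (intro add_mono max mix) auto
    \<comment> \<open>The common term \<open>(1 - t) * (rho \<sigma> Y l + 1)\<close> cancels; the
      remaining factor \<open>t\<close> can be divided out because \<open>t > 0\<close>.\<close>
    finally have "t * h t \<le> t * (rho \<sigma> Y l + 1)"
      by (simp add: algebra_simps)
    then show ?thesis using t by simp
  qed
  \<comment> \<open>The endpoint \<open>t = 0\<close>, where \<open>mix t\<close> is
    \<open>l\<close>, is reached only as a limit.\<close>
  moreover have "closure {0<..<1} = {0..1::real}" by simp
  ultimately have "h 0 \<le> rho \<sigma> Y l + 1"
    using continuous_le_on_closure[of "{0<..<1}" h 0 "rho \<sigma> Y l + 1"] cont by simp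
  then show ?thesis by (simp add: h_def mix_def)
qed

text \<open>The saddle inequality bounds the worst case at the headline of \<open>l\<close> from
  above, and the parabola of \<open>l\<close> bounds it strictly from below at every other action.
  Since \<open>l\<close> is arbitrary, all least favorable priors share one headline.\<close>

lemma least_favorable_optimal:
  fixes \<sigma> Y :: "real^'k"
  assumes \<sigma>: "\<forall>k. 0 < \<sigma> $ k"
    and \<Lambda>: "\<Lambda> \<subseteq> design_priors" "\<Lambda> \<noteq> {}" "compact \<Lambda>" "convex \<Lambda>"
    and l: "least_favorable \<sigma> Y \<Lambda> l"
  shows "is_optimal_headline \<sigma> Y \<Lambda> a \<longleftrightarrow> a = prior_headline \<sigma> Y l"
    and "optimal_headline \<sigma> Y \<Lambda> = prior_headline \<sigma> Y l"
    and "minimax_risk \<sigma> Y \<Lambda> = rho \<sigma> Y l + 1"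
    and "worst_case_risk \<sigma> Y \<Lambda> (prior_headline \<sigma> Y l) = rho \<sigma> Y l + 1"
proof -
  let ?a = "prior_headline \<sigma> Y l" and ?R = "worst_case_risk \<sigma> Y \<Lambda>"
  have l\<Lambda>: "l \<in> \<Lambda>" using l by (simp add: least_favorable_iff)
  then have ld: "l \<in> design_priors" using \<Lambda>(1) by blast
  have ge: "risk \<sigma> Y l b \<le> ?R b" for b
    using worst_case_risk_is_max[OF \<Lambda>(3,2), of \<sigma> Y b] l\<Lambda> by auto
  have "?R ?a \<le> rho \<sigma> Y l + 1"
    using worst_case_risk_is_max[OF \<Lambda>(3,2), of \<sigma> Y ?a] least_favorable_saddle[OF \<sigma> \<Lambda>(1,4) l]
    by auto
  then show R: "?R ?a = rho \<sigma> Y l + 1"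
    using ge[of ?a] by (simp add: risk_prior_headline)
  have less: "?R ?a < ?R b" if "b \<noteq> ?a" for b
  proof -
    have "?R ?a < risk \<sigma> Y l b"
      using that design_prior_precision_pos[OF \<sigma> ld] by (simp add: R risk_vertex_form[OF \<sigma> ld])
    then show ?thesis using ge[of b] by linarith
  qed
  then have le: "?R ?a \<le> ?R b" for b
    by (cases "b = ?a") (auto simp: less_imp_le)
  show iff: "is_optimal_headline \<sigma> Y \<Lambda> b \<longleftrightarrow> b = ?a" for b
    using less[of b] le unfolding is_optimal_headline_def is_arg_min_linorder
    by (metis leD)
  \<comment> \<open>\<open>arg_min\<close> is a choice operator; the equivalence above leaves it a
    single candidate.\<close>
  show "optimal_headline \<sigma> Y \<Lambda> = ?a"
    using iff by (simp add: optimal_headline_def arg_min_def flip: is_optimal_headline_def)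
  show "minimax_risk \<sigma> Y \<Lambda> = rho \<sigma> Y l + 1"
    unfolding minimax_risk_def using le R by (intro cInf_eq_minimum) (auto intro: range_eqI[OF sym])
qed

section \<open>Projection onto a real interval\<close>

text \<open>The equivalence yields existence and uniqueness of the closest point at once, and so
  fixes the value of \<open>arg_min\<close> in \<open>p_star\<close>.\<close>

lemma is_arg_min_dist_Icc_iff:
  fixes lo hi x q :: real
  assumes "lo \<le> hi"
  shows "is_arg_min (\<lambda>q. \<bar>q - x\<bar>) (\<lambda>q. q \<in> {lo..hi}) q \<longleftrightarrow> q = min (max x lo) hi"
proof
  assume "is_arg_min (\<lambda>q. \<bar>q - x\<bar>) (\<lambda>q. q \<in> {lo..hi}) q"
  \<comment> \<open>The clamped point itself is the only competitor needed.\<close>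
  then have "q \<in> {lo..hi}" "\<bar>q - x\<bar> \<le> \<bar>min (max x lo) hi - x\<bar>"
    using assms by (auto simp: is_arg_min_linorder)
  then show "q = min (max x lo) hi" by (auto simp: min_def max_def split: if_splits)
next
  assume "q = min (max x lo) hi"
  then show "is_arg_min (\<lambda>q. \<bar>q - x\<bar>) (\<lambda>q. q \<in> {lo..hi}) q"
    using assms by (auto simp: is_arg_min_linorder)
qed

text \<open>The projection of \<open>x\<close> lies on the segment from \<open>q\<close> to
  \<open>x\<close> and differs from \<open>q\<close>. It thus puts positive weight on
  \<open>x\<close>, and concavity carries part of the strict gain \<open>f q < f x\<close> over to
  it.\<close>

lemma concave_on_projection_less:
  fixes f :: "real \<Rightarrow> real"
  assumes f: "concave_on S f" and x: "x \<in> S" "\<And>q. q \<in> S \<Longrightarrow> q \<noteq> x \<Longrightarrow> f q < f x"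
    and I: "{lo..hi} \<subseteq> S" and q: "q \<in> {lo..hi}" "q \<noteq> min (max x lo) hi"
  shows "f q < f (min (max x lo) hi)"
proof -
  let ?p = "min (max x lo) hi"
  have qx: "q \<noteq> x" using q by auto
  \<comment> \<open>Relative position of the projection between \<open>q\<close> and
    \<open>x\<close>; it is \<open>1\<close> when \<open>x\<close> lies in the interval.\<close>
  define t where "t = (?p - q) / (x - q)"
  have t: "0 < t" "t \<le> 1"
    using q qx by (auto simp: t_def min_def max_def divide_simps split: if_splits)
  have p: "?p = (1 - t) * q + t * x"
  proof -
    have "t * (x - q) = ?p - q" using qx by (simp add: t_def)
    then show ?thesis by (simp add: algebra_simps)
  qed
  have "f q = (1 - t) * f q + t * f q" by (simp add: algebra_simps)
  also have "\<dots> < (1 - t) * f q + t * f x"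
    using t x(2)[of q] qx q I by auto
  also have "\<dots> \<le> f ?p"
    using f t x(1) q I unfolding p concave_on_iff by auto
  finally show ?thesis .
qed

section \<open>Two sources: priors parametrised by the weight on \<open>k1\<close>\<close>

context
  fixes k1 k2 :: "'k::finite" and \<sigma> Y :: "real^'k"
  assumes k12: "k1 \<noteq> k2" and UNIV2: "(UNIV :: 'k set) = {k1, k2}"
    and \<sigma>: "\<forall>k. 0 < \<sigma> $ k"
begin

lemma sum_UNIV_two: "(\<Sum>k\<in>UNIV. f k) = f k1 + f k2" for f :: "'k \<Rightarrow> real"
  using k12 by (simp add: UNIV2)

lemma two_prior_nth: "two_prior k1 p $ k1 = p" "two_prior k1 p $ k2 = 1 - p"
  using k12 by (auto simp: two_prior_def)

lemma two_prior_design: "two_prior k1 p \<in> design_priors \<longleftrightarrow> p \<in> {0..1}"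
proof -
  have "(\<forall>k. P k) \<longleftrightarrow> P k1 \<and> P k2" for P :: "'k \<Rightarrow> bool"
    using UNIV2 by (metis UNIV_I insertE singletonD)
  then show ?thesis by (simp add: design_priors_def sum_UNIV_two two_prior_nth)
qed

lemma design_prior_eq_two_prior:
  assumes "l \<in> design_priors"
  shows "l = two_prior k1 (l $ k1)"
proof -
  have "l $ k = two_prior k1 (l $ k1) $ k" for k
  proof -
    have "k = k1 \<or> k = k2" using UNIV2 by blast
    then show ?thesis
      using assms by (auto simp: two_prior_nth design_priors_def sum_UNIV_two)
  qed
  then show ?thesis by (intro iffD2[OF vec_eq_iff] allI)
qed

lemma two_prior_affine:
  assumes "u + v = 1"
  shows "two_prior k1 (u * p + v * q) = u *\<^sub>R two_prior k1 p + v *\<^sub>R two_prior k1 q"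
proof -
  have "u = 1 - v" using assms by simp
  then show ?thesis by (simp add: two_prior_def vec_eq_iff algebra_simps)
qed

lemma prior_headline_two_prior:
  "prior_headline \<sigma> Y (two_prior k1 p) =
    (p * Y $ k1 / (\<sigma> $ k1)\<^sup>2 + (1 - p) * Y $ k2 / (\<sigma> $ k2)\<^sup>2) /
    (p / (\<sigma> $ k1)\<^sup>2 + (1 - p) / (\<sigma> $ k2)\<^sup>2)"
  by (simp add: prior_headline_def sum_UNIV_two two_prior_nth)

lemma two_prior_denominator_pos:
  assumes "p \<in> {0..1}"
  shows "0 < p * (\<sigma> $ k2)\<^sup>2 + (1 - p) * (\<sigma> $ k1)\<^sup>2"
proof (cases "p = 0")
  case True
  then show ?thesis using \<sigma> by (simp add: less_le)
next
  case False
  moreover have "0 < \<sigma> $ k2" using \<sigma> by blast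
  ultimately show ?thesis
    using assms by (intro add_pos_nonneg mult_pos_pos mult_nonneg_nonneg) auto
qed

text \<open>Computed directly, since \<open>rho_pairwise\<close> assumes a linear order on the index
  type. The two residuals are \<open>(1 - p) * s1\<^sup>2 * d / N\<close> and
  \<open>- (p * s2\<^sup>2 * d / N)\<close>; in the weighted sum of their squares one factor
  \<open>N\<close> cancels.\<close>

lemma rho_two_prior:
  assumes p: "p \<in> {0..1}"
  shows "rho \<sigma> Y (two_prior k1 p) =
    p * (1 - p) * (Y $ k1 - Y $ k2)\<^sup>2 / (p * (\<sigma> $ k2)\<^sup>2 + (1 - p) * (\<sigma> $ k1)\<^sup>2)"
proof -
  define s1 s2 y1 y2 where [simp]: "s1 = \<sigma> $ k1" "s2 = \<sigma> $ k2" "y1 = Y $ k1" "y2 = Y $ k2"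
  \<comment> \<open>The total precision multiplied by
    \<open>s1\<^sup>2 * s2\<^sup>2\<close>.\<close>
  define N where "N = p * s2\<^sup>2 + (1 - p) * s1\<^sup>2"
  define d where "d = y1 - y2"
  have s: "s1 > 0" "s2 > 0" using \<sigma> by auto
  have N: "N > 0" using two_prior_denominator_pos[OF p] by (simp add: N_def)
  have den: "p / s1\<^sup>2 + (1 - p) / s2\<^sup>2 = N / (s1\<^sup>2 * s2\<^sup>2)"
    using s by (simp add: N_def field_simps)
  have num: "p * y1 / s1\<^sup>2 + (1 - p) * y2 / s2\<^sup>2 = (p * s2\<^sup>2 * y1 + (1 - p) * s1\<^sup>2 * y2) / (s1\<^sup>2 * s2\<^sup>2)"
    using s by (simp add: field_simps)
  have a: "prior_headline \<sigma> Y (two_prior k1 p) = (p * s2\<^sup>2 * y1 + (1 - p) * s1\<^sup>2 * y2) / N"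
    unfolding prior_headline_two_prior using den num s by simp
  have e1: "y1 - prior_headline \<sigma> Y (two_prior k1 p) = (1 - p) * s1\<^sup>2 * d / N"
    unfolding a using N by (simp add: field_simps d_def) (simp add: N_def algebra_simps)
  have e2: "y2 - prior_headline \<sigma> Y (two_prior k1 p) = - (p * s2\<^sup>2 * d / N)"
    unfolding a using N by (simp add: field_simps d_def) (simp add: N_def algebra_simps)
  have "rho \<sigma> Y (two_prior k1 p) =
      p * (y1 - prior_headline \<sigma> Y (two_prior k1 p))\<^sup>2 / s1\<^sup>2 +
      (1 - p) * (y2 - prior_headline \<sigma> Y (two_prior k1 p))\<^sup>2 / s2\<^sup>2"
    by (simp add: rho_def D_def sum_UNIV_two two_prior_nth power_divide)
  also have "\<dots> = p * (1 - p) * d\<^sup>2 * N / N\<^sup>2"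
  proof -
    have "p * ((1 - p) * s1\<^sup>2 * d / N)\<^sup>2 / s1\<^sup>2 = p * (1 - p) * d\<^sup>2 * ((1 - p) * s1\<^sup>2) / N\<^sup>2"
      using s by (simp add: power2_eq_square)
    moreover have "(1 - p) * (p * s2\<^sup>2 * d / N)\<^sup>2 / s2\<^sup>2 = p * (1 - p) * d\<^sup>2 * (p * s2\<^sup>2) / N\<^sup>2"
      using s by (simp add: power2_eq_square)
    ultimately show ?thesis
      unfolding e1 e2 power2_minus by (simp add: N_def add_divide_distrib distrib_left)
  qed
  also have "\<dots> = p * (1 - p) * d\<^sup>2 / N"
    using N by (simp add: power2_eq_square)
  finally show ?thesis by (simp add: d_def N_def)
qed

lemma p_Delta_mem: "p_Delta \<sigma> k1 k2 \<in> {0..1}"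
  using \<sigma> by (auto simp: p_Delta_def divide_simps add_pos_pos less_imp_le add_nonneg_nonneg)

text \<open>Exhibits the maximum without derivatives: the value at \<open>p_Delta\<close> minus a
  square over a positive denominator. It rests on the identity
  \<open>N = p * (1 - p) * s\<^sup>2 + (p * s - s1)\<^sup>2\<close>.\<close>

lemma rho_two_prior_deficit:
  assumes p: "p \<in> {0..1}"
  shows "rho \<sigma> Y (two_prior k1 p) = (Y $ k1 - Y $ k2)\<^sup>2 *
    (1 / (\<sigma> $ k1 + \<sigma> $ k2)\<^sup>2 - (p - p_Delta \<sigma> k1 k2)\<^sup>2 / (p * (\<sigma> $ k2)\<^sup>2 + (1 - p) * (\<sigma> $ k1)\<^sup>2))"
proof -
  define s1 s2 where [simp]: "s1 = \<sigma> $ k1" "s2 = \<sigma> $ k2"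
  define N where "N = p * s2\<^sup>2 + (1 - p) * s1\<^sup>2"
  define s where "s = s1 + s2"
  have s: "s > 0" using \<sigma> by (simp add: s_def add_pos_pos)
  have N: "N > 0" using two_prior_denominator_pos[OF p] by (simp add: N_def)
  have "N = p * (1 - p) * s\<^sup>2 + (p * s - s1)\<^sup>2"
    by (simp add: N_def s_def power2_eq_square algebra_simps)
  also have "(p * s - s1)\<^sup>2 = s\<^sup>2 * (p - s1 / s)\<^sup>2"
    using s by (simp add: field_simps power2_eq_square)
  finally have "N / s\<^sup>2 = p * (1 - p) + (p - s1 / s)\<^sup>2"
    using s by (simp add: field_simps)
  then have "1 / s\<^sup>2 = (p * (1 - p) + (p - s1 / s)\<^sup>2) / N"
    using N by (metis divide_divide_eq_left divide_self_if less_irrefl mult.commute)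
  then have "1 / s\<^sup>2 - (p - s1 / s)\<^sup>2 / N = p * (1 - p) / N"
    by (simp add: add_divide_distrib)
  then have "p * (1 - p) * (Y $ k1 - Y $ k2)\<^sup>2 / N =
      (Y $ k1 - Y $ k2)\<^sup>2 * (1 / s\<^sup>2 - (p - s1 / s)\<^sup>2 / N)"
    by simp
  then show ?thesis
    unfolding rho_two_prior[OF p] by (simp add: N_def s_def p_Delta_def)
qed

lemma rho_two_prior_less_p_Delta:
  assumes "Y $ k1 \<noteq> Y $ k2" "p \<in> {0..1}" "p \<noteq> p_Delta \<sigma> k1 k2"
  shows "rho \<sigma> Y (two_prior k1 p) < rho \<sigma> Y (two_prior k1 (p_Delta \<sigma> k1 k2))"
  using assms two_prior_denominator_pos[OF assms(2)]
  unfolding rho_two_prior_deficit[OF assms(2)] rho_two_prior_deficit[OF p_Delta_mem]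
  by (intro mult_strict_left_mono) auto

lemma rho_two_prior_eq_zero:
  assumes "Y $ k1 = Y $ k2" "p \<in> {0..1}"
  shows "rho \<sigma> Y (two_prior k1 p) = 0"
  using assms by (simp add: rho_two_prior)

lemma p_Delta_arg_max:
  "is_arg_max (\<lambda>q. rho \<sigma> Y (two_prior k1 q)) (\<lambda>q. q \<in> {0..1}) (p_Delta \<sigma> k1 k2)"
  unfolding is_arg_max_linorder
proof (intro conjI allI impI p_Delta_mem)
  fix q :: real assume q: "q \<in> {0..1}"
  show "rho \<sigma> Y (two_prior k1 q) \<le> rho \<sigma> Y (two_prior k1 (p_Delta \<sigma> k1 k2))"
  proof (cases "Y $ k1 = Y $ k2 \<or> q = p_Delta \<sigma> k1 k2")
    case True
    then show ?thesis using rho_two_prior_eq_zero[OF _ q] rho_two_prior_eq_zero[OF _ p_Delta_mem]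
      by auto
  next
    case False
    then show ?thesis using rho_two_prior_less_p_Delta q by (simp add: less_imp_le)
  qed
qed

lemma p_Delta_arg_max_unique:
  assumes "Y $ k1 \<noteq> Y $ k2"
    and "is_arg_max (\<lambda>q. rho \<sigma> Y (two_prior k1 q)) (\<lambda>q. q \<in> {0..1}) q"
  shows "q = p_Delta \<sigma> k1 k2"
  using assms rho_two_prior_less_p_Delta p_Delta_mem by (fastforce simp: is_arg_max_def)

text \<open>Inherited from \<open>concave_on_rho\<close>, as \<open>two_prior\<close> is affine in
  the weight.\<close>

lemma concave_on_rho_two_prior: "concave_on {0..1} (\<lambda>q. rho \<sigma> Y (two_prior k1 q))"
  unfolding concave_on_iff
proof (intro conjI ballI allI impI)
  fix p q u v :: real
  assume "p \<in> {0..1}" "q \<in> {0..1}" "u \<ge> 0" "v \<ge> 0" "u + v = 1"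
  then show "u * rho \<sigma> Y (two_prior k1 p) + v * rho \<sigma> Y (two_prior k1 q)
      \<le> rho \<sigma> Y (two_prior k1 (u *\<^sub>R p + v *\<^sub>R q))"
    using concave_on_rho[OF \<sigma>, of Y] two_prior_design
    unfolding concave_on_iff by (simp add: two_prior_affine)
qed simp

lemma prior_headline_degenerate:
  assumes "Y $ k1 = Y $ k2" "l \<in> design_priors"
  shows "prior_headline \<sigma> Y l = Y $ k1"
proof -
  have "prior_headline \<sigma> Y l =
      Y $ k1 * (\<Sum>k\<in>UNIV. l $ k / (\<sigma> $ k)\<^sup>2) / (\<Sum>k\<in>UNIV. l $ k / (\<sigma> $ k)\<^sup>2)"
    using assms(1) by (simp add: prior_headline_def sum_UNIV_two distrib_left mult.commute)
  then show ?thesis using design_prior_precision_pos[OF \<sigma> assms(2)] by simp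
qed

section \<open>Two sources with a restricted set of priors\<close>

context
  fixes \<Lambda> :: "(real^'k) set"
  assumes \<Lambda>: "\<Lambda> \<subseteq> design_priors" "\<Lambda> \<noteq> {}" "compact \<Lambda>" "convex \<Lambda>"
begin

text \<open>Viewing the set as a coordinate projection transfers connectedness and compactness from
  \<open>\<Lambda>\<close>, which makes it a closed interval.\<close>

lemma I_set_eq_image: "I_set \<Lambda> k1 = (\<lambda>l. l $ k1) ` \<Lambda>"
proof (intro set_eqI iffI)
  fix p assume "p \<in> I_set \<Lambda> k1"
  then show "p \<in> (\<lambda>l. l $ k1) ` \<Lambda>"
    by (intro image_eqI[of _ _ "two_prior k1 p"]) (auto simp: I_set_def two_prior_nth)
next
  fix p assume "p \<in> (\<lambda>l. l $ k1) ` \<Lambda>"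
  then obtain l where l: "l \<in> \<Lambda>" "p = l $ k1" by blast
  then have "l = two_prior k1 p" using design_prior_eq_two_prior \<Lambda>(1) by blast
  then have "two_prior k1 p \<in> \<Lambda>" using l(1) by simp
  then show "p \<in> I_set \<Lambda> k1"
    using \<Lambda>(1) two_prior_design[of p] by (auto simp: I_set_def)
qed

lemma I_set_Icc:
  "p_lower \<Lambda> k1 \<le> p_upper \<Lambda> k1" "I_set \<Lambda> k1 = {p_lower \<Lambda> k1..p_upper \<Lambda> k1}"
proof -
  have "continuous_on \<Lambda> (\<lambda>l. l $ k1)" by (intro continuous_intros)
  then have "connected (I_set \<Lambda> k1) \<and> compact (I_set \<Lambda> k1)"
    unfolding I_set_eq_image using \<Lambda>
    by (auto intro: connected_continuous_image convex_connected compact_continuous_image)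
  then obtain a b where ab: "I_set \<Lambda> k1 = {a..b}"
    by (auto simp: connected_compact_interval_1)
  moreover have "I_set \<Lambda> k1 \<noteq> {}" using \<Lambda>(2) by (simp add: I_set_eq_image)
  ultimately have "a \<le> b" by simp
  then show "p_lower \<Lambda> k1 \<le> p_upper \<Lambda> k1" "I_set \<Lambda> k1 = {p_lower \<Lambda> k1..p_upper \<Lambda> k1}"
    using ab by (simp_all add: p_lower_def p_upper_def)
qed

lemma p_star_eq:
  "p_star \<sigma> \<Lambda> k1 k2 = min (max (p_Delta \<sigma> k1 k2) (p_lower \<Lambda> k1)) (p_upper \<Lambda> k1)"
  unfolding p_star_def arg_min_def I_set_Icc(2) is_arg_min_dist_Icc_iff[OF I_set_Icc(1)] by simp

lemma p_star_mem: "p_star \<sigma> \<Lambda> k1 k2 \<in> I_set \<Lambda> k1"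
  using I_set_Icc(1) by (auto simp: p_star_eq I_set_Icc(2))

lemma design_prior_in_\<Lambda>E:
  assumes "l \<in> \<Lambda>"
  obtains q where "q \<in> I_set \<Lambda> k1" "l = two_prior k1 q"
  using assms design_prior_eq_two_prior \<Lambda>(1) unfolding I_set_eq_image by blast

lemma rho_less_p_star:
  assumes "Y $ k1 \<noteq> Y $ k2" "q \<in> I_set \<Lambda> k1" "q \<noteq> p_star \<sigma> \<Lambda> k1 k2"
  shows "rho \<sigma> Y (two_prior k1 q) < rho \<sigma> Y (two_prior k1 (p_star \<sigma> \<Lambda> k1 k2))"
proof -
  have "I_set \<Lambda> k1 \<subseteq> {0..1}" by (auto simp: I_set_def)
  then show ?thesis
    using assms rho_two_prior_less_p_Delta unfolding p_star_eq I_set_Icc(2)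
    by (intro concave_on_projection_less[OF concave_on_rho_two_prior p_Delta_mem]) auto
qed

lemma least_favorable_degenerate:
  assumes "Y $ k1 = Y $ k2" "l \<in> \<Lambda>"
  shows "least_favorable \<sigma> Y \<Lambda> l"
proof -
  have "rho \<sigma> Y m = 0" if "m \<in> \<Lambda>" for m
    using that rho_two_prior_eq_zero[OF assms(1)]
    by (elim design_prior_in_\<Lambda>E) (auto simp: I_set_def)
  then show ?thesis using assms(2) by (simp add: least_favorable_iff)
qed

text \<open>Covers equal and distinct estimates alike, so the headline and risk formulas for two
  sources follow from \<open>least_favorable_optimal\<close> with no case split.\<close>

lemma least_favorable_p_star: "least_favorable \<sigma> Y \<Lambda> (two_prior k1 (p_star \<sigma> \<Lambda> k1 k2))"
proof (cases "Y $ k1 = Y $ k2")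
  case True
  then show ?thesis using least_favorable_degenerate p_star_mem by (simp add: I_set_def)
next
  case False
  then have "rho \<sigma> Y (two_prior k1 q) \<le> rho \<sigma> Y (two_prior k1 (p_star \<sigma> \<Lambda> k1 k2))"
    if "q \<in> I_set \<Lambda> k1" for q
    using rho_less_p_star[OF False that] by (cases "q = p_star \<sigma> \<Lambda> k1 k2") auto
  then show ?thesis
    using p_star_mem by (auto simp: least_favorable_iff I_set_def elim!: design_prior_in_\<Lambda>E)
qed

lemma least_favorable_unique:
  assumes "Y $ k1 \<noteq> Y $ k2"
  shows "least_favorable \<sigma> Y \<Lambda> l \<longleftrightarrow> l = two_prior k1 (p_star \<sigma> \<Lambda> k1 k2)"
proof
  assume l: "least_favorable \<sigma> Y \<Lambda> l"
  then obtain q where q: "q \<in> I_set \<Lambda> k1" "l = two_prior k1 q"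
    by (auto simp: least_favorable_iff elim: design_prior_in_\<Lambda>E)
  have "rho \<sigma> Y (two_prior k1 (p_star \<sigma> \<Lambda> k1 k2)) \<le> rho \<sigma> Y l"
    using l p_star_mem by (auto simp: least_favorable_iff I_set_def)
  then show "l = two_prior k1 (p_star \<sigma> \<Lambda> k1 k2)"
    using rho_less_p_star[OF assms q(1)] q(2) by fastforce
qed (simp add: least_favorable_p_star)

end

end

theorem proposition2:
  fixes \<sigma> Y :: "real^'k" and \<Lambda> :: "(real^'k) set"
  assumes "CARD('k) \<ge> 2"
    and "\<forall>k. 0 < \<sigma> $ k"
    and "\<Lambda> \<subseteq> design_priors" and "\<Lambda> \<noteq> {}" and "compact \<Lambda>" and "convex \<Lambda>"
  shows
    "(\<exists>!a. is_optimal_headline \<sigma> Y \<Lambda> a) \<and>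
     (\<exists>l\<in>\<Lambda>.
        is_arg_max (rho \<sigma> Y) (\<lambda>m. m \<in> \<Lambda>) l \<and>
        optimal_headline \<sigma> Y \<Lambda> = prior_headline \<sigma> Y l \<and>
        minimax_risk \<sigma> Y \<Lambda> = rho \<sigma> Y l + 1 \<and>
        worst_case_risk \<sigma> Y \<Lambda> (optimal_headline \<sigma> Y \<Lambda>) = risk \<sigma> Y l (optimal_headline \<sigma> Y \<Lambda>)) \<and>
     (\<forall>k1 k2. k1 \<noteq> k2 \<and> (UNIV :: 'k set) = {k1, k2} \<longrightarrow>
        (let s1 = \<sigma> $ k1; s2 = \<sigma> $ k2; y1 = Y $ k1; y2 = Y $ k2;
             p\<Delta> = p_Delta \<sigma> k1 k2; I = I_set \<Lambda> k1;
             lo = p_lower \<Lambda> k1; hi = p_upper \<Lambda> k1; p = p_star \<sigma> \<Lambda> k1 k2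
         in
           is_arg_max (\<lambda>q. rho \<sigma> Y (two_prior k1 q)) (\<lambda>q. q \<in> {0..1}) p\<Delta> \<and>
           (y1 \<noteq> y2 \<longrightarrow>
             (\<forall>q. is_arg_max (\<lambda>q. rho \<sigma> Y (two_prior k1 q)) (\<lambda>q. q \<in> {0..1}) q \<longrightarrow> q = p\<Delta>)) \<and>
           (\<forall>q\<in>{0..1}. rho \<sigma> Y (two_prior k1 q) =
              q * (1 - q) * (y1 - y2)\<^sup>2 / (q * s2\<^sup>2 + (1 - q) * s1\<^sup>2)) \<and>
           lo \<le> hi \<and> I = {lo..hi} \<and>
           (\<exists>!q. is_arg_min (\<lambda>q. \<bar>q - p\<Delta>\<bar>) (\<lambda>q. q \<in> I) q) \<and>
           p = min (max p\<Delta> lo) hi \<and>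
           optimal_headline \<sigma> Y \<Lambda> =
             (p * y1 / s1\<^sup>2 + (1 - p) * y2 / s2\<^sup>2) / (p / s1\<^sup>2 + (1 - p) / s2\<^sup>2) \<and>
           minimax_risk \<sigma> Y \<Lambda> =
             p * (1 - p) * (y1 - y2)\<^sup>2 / (p * s2\<^sup>2 + (1 - p) * s1\<^sup>2) + 1 \<and>
           (y1 \<noteq> y2 \<longrightarrow> (\<forall>l. least_favorable \<sigma> Y \<Lambda> l \<longleftrightarrow> l = two_prior k1 p)) \<and>
           (y1 = y2 \<longrightarrow>
             (\<forall>l\<in>\<Lambda>. least_favorable \<sigma> Y \<Lambda> l) \<and>
             optimal_headline \<sigma> Y \<Lambda> = y1 \<and> optimal_headline \<sigma> Y \<Lambda> = y2 \<and>
             minimax_risk \<sigma> Y \<Lambda> = 1)))"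
proof (intro conjI allI impI, goal_cases)
  case 1
  obtain l where "least_favorable \<sigma> Y \<Lambda> l"
    using least_favorable_exists assms by blast
  from least_favorable_optimal(1)[OF assms(2-6) this] show ?case by simp
next
  case 2
  obtain l where l: "least_favorable \<sigma> Y \<Lambda> l"
    using least_favorable_exists assms by blast
  show ?case
  proof (intro bexI[of _ l] conjI)
    show "is_arg_max (rho \<sigma> Y) (\<lambda>m. m \<in> \<Lambda>) l"
      using l by (simp add: least_favorable_def)
    show "l \<in> \<Lambda>"
      using l by (simp add: least_favorable_iff)
  \<comment> \<open>In the worst-case claim both sides equal
    \<open>rho \<sigma> Y l + 1\<close>.\<close>
  qed (simp_all add: least_favorable_optimal(2-)[OF assms(2-6) l] risk_prior_headline)
next
  case (3 k1 k2)
  then have two: "k1 \<noteq> k2" "(UNIV :: 'k set) = {k1, k2}" by blast+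
  note ctx = two assms(2)
  note ctx\<Lambda> = ctx assms(3-6)
  let ?p = "p_star \<sigma> \<Lambda> k1 k2"
  have p01: "?p \<in> {0..1}" and p\<Lambda>: "two_prior k1 ?p \<in> \<Lambda>"
    using p_star_mem[OF ctx\<Lambda>] by (auto simp: I_set_def)
  note opt = least_favorable_optimal[OF assms(2-6) least_favorable_p_star[OF ctx\<Lambda>, of Y]]
  show ?case
    unfolding Let_def
  proof (intro conjI)
    show "is_arg_max (\<lambda>q. rho \<sigma> Y (two_prior k1 q)) (\<lambda>q. q \<in> {0..1}) (p_Delta \<sigma> k1 k2)"
      by (rule p_Delta_arg_max[OF ctx])
    show "Y $ k1 \<noteq> Y $ k2 \<longrightarrow> (\<forall>q. is_arg_max (\<lambda>q. rho \<sigma> Y (two_prior k1 q))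
        (\<lambda>q. q \<in> {0..1}) q \<longrightarrow> q = p_Delta \<sigma> k1 k2)"
      by (intro impI allI p_Delta_arg_max_unique[OF ctx])
    show "\<forall>q\<in>{0..1}. rho \<sigma> Y (two_prior k1 q) =
        q * (1 - q) * (Y $ k1 - Y $ k2)\<^sup>2 / (q * (\<sigma> $ k2)\<^sup>2 + (1 - q) * (\<sigma> $ k1)\<^sup>2)"
      by (intro ballI rho_two_prior[OF ctx])
    show "p_lower \<Lambda> k1 \<le> p_upper \<Lambda> k1" "I_set \<Lambda> k1 = {p_lower \<Lambda> k1..p_upper \<Lambda> k1}"
      by (rule I_set_Icc[OF ctx\<Lambda>])+
    show "\<exists>!q. is_arg_min (\<lambda>q. \<bar>q - p_Delta \<sigma> k1 k2\<bar>) (\<lambda>q. q \<in> I_set \<Lambda> k1) q"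
      unfolding I_set_Icc(2)[OF ctx\<Lambda>] is_arg_min_dist_Icc_iff[OF I_set_Icc(1)[OF ctx\<Lambda>]] by simp
    show "?p = min (max (p_Delta \<sigma> k1 k2) (p_lower \<Lambda> k1)) (p_upper \<Lambda> k1)"
      by (rule p_star_eq[OF ctx\<Lambda>])
    show "optimal_headline \<sigma> Y \<Lambda> =
        (?p * Y $ k1 / (\<sigma> $ k1)\<^sup>2 + (1 - ?p) * Y $ k2 / (\<sigma> $ k2)\<^sup>2) /
        (?p / (\<sigma> $ k1)\<^sup>2 + (1 - ?p) / (\<sigma> $ k2)\<^sup>2)"
      unfolding opt(2) by (rule prior_headline_two_prior[OF ctx])
    show "minimax_risk \<sigma> Y \<Lambda> = ?p * (1 - ?p) * (Y $ k1 - Y $ k2)\<^sup>2 /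
        (?p * (\<sigma> $ k2)\<^sup>2 + (1 - ?p) * (\<sigma> $ k1)\<^sup>2) + 1"
      unfolding opt(3) rho_two_prior[OF ctx p01] ..
    show "Y $ k1 \<noteq> Y $ k2 \<longrightarrow> (\<forall>l. least_favorable \<sigma> Y \<Lambda> l \<longleftrightarrow> l = two_prior k1 ?p)"
      by (intro impI allI least_favorable_unique[OF ctx\<Lambda>])
    show "Y $ k1 = Y $ k2 \<longrightarrow>
        (\<forall>l\<in>\<Lambda>. least_favorable \<sigma> Y \<Lambda> l) \<and>
        optimal_headline \<sigma> Y \<Lambda> = Y $ k1 \<and> optimal_headline \<sigma> Y \<Lambda> = Y $ k2 \<and>
        minimax_risk \<sigma> Y \<Lambda> = 1"
    proof
      assume eq: "Y $ k1 = Y $ k2"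
      have "two_prior k1 ?p \<in> design_priors" using p\<Lambda> assms(3) by blast
      then have "optimal_headline \<sigma> Y \<Lambda> = Y $ k1"
        unfolding opt(2) by (rule prior_headline_degenerate[OF ctx eq])
      moreover have "minimax_risk \<sigma> Y \<Lambda> = 1"
        unfolding opt(3) rho_two_prior_eq_zero[OF ctx eq p01] by simp
      ultimately show "(\<forall>l\<in>\<Lambda>. least_favorable \<sigma> Y \<Lambda> l) \<and>
          optimal_headline \<sigma> Y \<Lambda> = Y $ k1 \<and> optimal_headline \<sigma> Y \<Lambda> = Y $ k2 \<and>
          minimax_risk \<sigma> Y \<Lambda> = 1"
        using least_favorable_degenerate[OF ctx\<Lambda> eq] eq by simp
    qed
  qed
qed

end
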